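(* Let $(\mathfrak{g},[\cdot,\cdot])$ be a Leibniz algebra, $(V,\rho^L,\rho^R)$ a representation of it, $H:\mathfrak{g}\otimes\mathfrak{g}\to V$ a $2$-cocycle of $\mathfrak{g}$ with coefficients in $V$, and $K:V\to\mathfrak{g}$ an $H$-twisted relative Rota-Baxter operator. Define maps $\overline{\rho}^L,\overline{\rho}^R:V\to gl(\mathfrak{g})$ by $$\overline{\rho}^L(u)x=[Ku,x]-K(\rho^R(x)u)-KH(Ku,x),\qquad \overline{\rho}^R(u)x=[x,Ku]-K(\rho^L(x)u)-KH(x,Ku),$$ for $u\in V$, $x\in\mathfrak{g}$. Then $(\mathfrak{g},\overline{\rho}^L,\overline{\rho}^R)$ is a representation of the Leibniz algebra $(V,[\cdot,\cdot]_K)$, where $[u,v]_K=\rho^L(Ku)v+\rho^R(Kv)u+H(Ku,Kv)$ for $u,v\in V$.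
   Context: All vector spaces are finite-dimensional over $\mathbb{C}$. A Leibniz algebra is a vector space $\mathfrak{g}$ with a bilinear bracket satisfying $[x,[y,z]]=[[x,y],z]+[y,[x,z]]$ for all $x,y,z\in\mathfrak{g}$. A representation of $\mathfrak{g}$ is a triple $(V,\rho^L,\rho^R)$ with $V$ a vector space and linear maps $\rho^L,\rho^R:\mathfrak{g}\to gl(V)$ such that for all $x,y\in\mathfrak{g}$: $\rho^L([x,y])=\rho^L(x)\rho^L(y)-\rho^L(y)\rho^L(x)$, $\rho^R([x,y])=\rho^L(x)\rho^R(y)-\rho^R(y)\rho^L(x)$, and $\rho^R([x,y])=\rho^L(x)\rho^R(y)+\rho^R(y)\rho^R(x)$. A $2$-cocycle of $\mathfrak{g}$ with coefficients in $V$ is a bilinear map $H:\mathfrak{g}\otimes\mathfrak{g}\to V$ with $\rho^L(x)H(y,z)-\rho^L(y)H(x,z)-\rho^R(z)H(x,y)-H([x,y],z)-H(y,[x,z])+H(x,[y,z])=0$ for all $x,y,z\in\mathfrak{g}$. A linear map $K:V\to\mathfrak{g}$ is an $H$-twisted relative Rota-Baxter operator if $[Ku,Kv]=K(\rho^L(Ku)v+\rho^R(Kv)u+H(Ku,Kv))$ for all $u,v\in V$. For such $K$, the bracket $[\cdot,\cdot]_K$ makes $V$ a Leibniz algebra. *)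

theory Defs
  imports Complex_Main
begin

text \<open>Vector spaces are given by the scalar multiplication on a whole type; bases are not part of
  the data, so finite-dimensionality is stated by the existence of a finite spanning set.\<close>

locale fd_complex_space = vector_space scale
  for scale :: "complex \<Rightarrow> 'a::ab_group_add \<Rightarrow> 'a" +
  assumes finite_dimensional: "\<exists>B. finite B \<and> span B = UNIV"

definition bilinear_map ::
  "(complex \<Rightarrow> 'a::ab_group_add \<Rightarrow> 'a) \<Rightarrow> (complex \<Rightarrow> 'b::ab_group_add \<Rightarrow> 'b) \<Rightarrow>
   (complex \<Rightarrow> 'c::ab_group_add \<Rightarrow> 'c) \<Rightarrow> ('a \<Rightarrow> 'b \<Rightarrow> 'c) \<Rightarrow> bool" where
  "bilinear_map sA sB sC f \<longleftrightarrow>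
     (\<forall>x. Vector_Spaces.linear sB sC (f x)) \<and>
     (\<forall>y. Vector_Spaces.linear sA sC (\<lambda>x. f x y))"

text \<open>A linear map from \<open>A\<close> to \<open>gl(B)\<close>: its values are linear endomorphisms of \<open>B\<close>, and it is
  linear for the pointwise vector space structure of \<open>gl(B)\<close>.\<close>

definition linear_map_to_gl ::
  "(complex \<Rightarrow> 'a::ab_group_add \<Rightarrow> 'a) \<Rightarrow> (complex \<Rightarrow> 'b::ab_group_add \<Rightarrow> 'b) \<Rightarrow>
   ('a \<Rightarrow> 'b \<Rightarrow> 'b) \<Rightarrow> bool" where
  "linear_map_to_gl sA sB r \<longleftrightarrow>
     (\<forall>x. Vector_Spaces.linear sB sB (r x)) \<and>
     (\<forall>v. Vector_Spaces.linear sA sB (\<lambda>x. r x v))"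

locale leibniz_algebra = fd_complex_space scale
  for scale :: "complex \<Rightarrow> 'g::ab_group_add \<Rightarrow> 'g"
  and br :: "'g \<Rightarrow> 'g \<Rightarrow> 'g" +
  assumes bilinear_br: "bilinear_map scale scale scale br"
    and leibniz: "br x (br y z) = br (br x y) z + br y (br x z)"

text \<open>The locale includes that \<open>(sG, br)\<close> is a Leibniz algebra.\<close>

locale leibniz_representation =
  G: leibniz_algebra sG br + V: fd_complex_space sV
  for sG :: "complex \<Rightarrow> 'g::ab_group_add \<Rightarrow> 'g"
  and br :: "'g \<Rightarrow> 'g \<Rightarrow> 'g"
  and sV :: "complex \<Rightarrow> 'v::ab_group_add \<Rightarrow> 'v"
  and rhoL :: "'g \<Rightarrow> 'v \<Rightarrow> 'v"
  and rhoR :: "'g \<Rightarrow> 'v \<Rightarrow> 'v" +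
  assumes rhoL_linear: "linear_map_to_gl sG sV rhoL"
    and rhoR_linear: "linear_map_to_gl sG sV rhoR"
    and rhoL_br: "rhoL (br x y) v = rhoL x (rhoL y v) - rhoL y (rhoL x v)"
    and rhoR_br_commutator: "rhoR (br x y) v = rhoL x (rhoR y v) - rhoR y (rhoL x v)"
    and rhoR_br_sum: "rhoR (br x y) v = rhoL x (rhoR y v) + rhoR y (rhoR x v)"

definition leibniz_2cocycle ::
  "(complex \<Rightarrow> 'g::ab_group_add \<Rightarrow> 'g) \<Rightarrow> ('g \<Rightarrow> 'g \<Rightarrow> 'g) \<Rightarrow>
   (complex \<Rightarrow> 'v::ab_group_add \<Rightarrow> 'v) \<Rightarrow> ('g \<Rightarrow> 'v \<Rightarrow> 'v) \<Rightarrow> ('g \<Rightarrow> 'v \<Rightarrow> 'v) \<Rightarrow>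
   ('g \<Rightarrow> 'g \<Rightarrow> 'v) \<Rightarrow> bool" where
  "leibniz_2cocycle sG br sV rhoL rhoR H \<longleftrightarrow>
     bilinear_map sG sG sV H \<and>
     (\<forall>x y z. rhoL x (H y z) - rhoL y (H x z) - rhoR z (H x y)
               - H (br x y) z - H y (br x z) + H x (br y z) = 0)"

definition twisted_bracket ::
  "('g \<Rightarrow> 'v \<Rightarrow> 'v) \<Rightarrow> ('g \<Rightarrow> 'v \<Rightarrow> 'v) \<Rightarrow> ('g \<Rightarrow> 'g \<Rightarrow> 'v) \<Rightarrow> ('v \<Rightarrow> 'g) \<Rightarrow>
   'v \<Rightarrow> 'v \<Rightarrow> 'v::ab_group_add" where
  "twisted_bracket rhoL rhoR H K u v = rhoL (K u) v + rhoR (K v) u + H (K u) (K v)"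

definition twisted_rota_baxter ::
  "(complex \<Rightarrow> 'g::ab_group_add \<Rightarrow> 'g) \<Rightarrow> ('g \<Rightarrow> 'g \<Rightarrow> 'g) \<Rightarrow>
   (complex \<Rightarrow> 'v::ab_group_add \<Rightarrow> 'v) \<Rightarrow> ('g \<Rightarrow> 'v \<Rightarrow> 'v) \<Rightarrow> ('g \<Rightarrow> 'v \<Rightarrow> 'v) \<Rightarrow>
   ('g \<Rightarrow> 'g \<Rightarrow> 'v) \<Rightarrow> ('v \<Rightarrow> 'g) \<Rightarrow> bool" where
  "twisted_rota_baxter sG br sV rhoL rhoR H K \<longleftrightarrow>
     Vector_Spaces.linear sV sG K \<and>
     (\<forall>u v. br (K u) (K v) = K (rhoL (K u) v + rhoR (K v) u + H (K u) (K v)))"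

definition rhoL_bar ::
  "('g \<Rightarrow> 'g \<Rightarrow> 'g::ab_group_add) \<Rightarrow> ('g \<Rightarrow> 'v \<Rightarrow> 'v) \<Rightarrow> ('g \<Rightarrow> 'g \<Rightarrow> 'v) \<Rightarrow> ('v \<Rightarrow> 'g) \<Rightarrow>
   'v \<Rightarrow> 'g \<Rightarrow> 'g" where
  "rhoL_bar br rhoR H K u x = br (K u) x - K (rhoR x u) - K (H (K u) x)"

definition rhoR_bar ::
  "('g \<Rightarrow> 'g \<Rightarrow> 'g::ab_group_add) \<Rightarrow> ('g \<Rightarrow> 'v \<Rightarrow> 'v) \<Rightarrow> ('g \<Rightarrow> 'g \<Rightarrow> 'v) \<Rightarrow> ('v \<Rightarrow> 'g) \<Rightarrow>
   'v \<Rightarrow> 'g \<Rightarrow> 'g" where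
  "rhoR_bar br rhoL H K u x = br x (K u) - K (rhoL x u) - K (H x (K u))"

end

theory Submission
  imports Defs
begin

text \<open>The cocycle \<open>H\<close> turns \<open>g \<oplus> V\<close> into a Leibniz algebra, an abelian extension of \<open>g\<close> by \<open>V\<close>, and
  the twisted Rota--Baxter identity says that the graph \<open>{(K u, u)}\<close> is a subalgebra; it is a copy
  of \<open>V\<close> with the bracket \<open>[u, v]\<^sub>K\<close>. A subalgebra acts by left and right multiplication on the
  ambient algebra and on itself, hence on the quotient. The quotient by the graph is identified
  with \<open>g\<close> through \<open>(x, u) \<mapsto> x - K u\<close>, and the resulting action is the one defined by the barred
  maps.\<close>

locale twisted_rota_baxter_operator = leibniz_representation sG br sV rhoL rhoR
  for sG :: "complex \<Rightarrow> 'g::ab_group_add \<Rightarrow> 'g"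
  and br :: "'g \<Rightarrow> 'g \<Rightarrow> 'g"
  and sV :: "complex \<Rightarrow> 'v::ab_group_add \<Rightarrow> 'v"
  and rhoL :: "'g \<Rightarrow> 'v \<Rightarrow> 'v"
  and rhoR :: "'g \<Rightarrow> 'v \<Rightarrow> 'v" +
  fixes H :: "'g \<Rightarrow> 'g \<Rightarrow> 'v"
  and K :: "'v \<Rightarrow> 'g"
  assumes cocycle: "leibniz_2cocycle sG br sV rhoL rhoR H"
    and operator: "twisted_rota_baxter sG br sV rhoL rhoR H K"
begin

lemma K_linear: "Vector_Spaces.linear sV sG K"
  using operator by (simp add: twisted_rota_baxter_def)

lemma H_bilinear: "bilinear_map sG sG sV H"
  using cocycle by (simp add: leibniz_2cocycle_def)

lemma add_simps:
  "br (x + x') y = br x y + br x' y" "br x (y + y') = br x y + br x y'"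
  "H (x + x') y = H x y + H x' y" "H x (y + y') = H x y + H x y'"
  "rhoL (x + x') v = rhoL x v + rhoL x' v" "rhoL x (v + v') = rhoL x v + rhoL x v'"
  "rhoR (x + x') v = rhoR x v + rhoR x' v" "rhoR x (v + v') = rhoR x v + rhoR x v'"
  "K (v + v') = K v + K v'"
  using G.bilinear_br H_bilinear rhoL_linear rhoR_linear K_linear
  by (simp_all add: bilinear_map_def linear_map_to_gl_def Vector_Spaces.linear_iff)

lemma scale_simps:
  "br (sG c x) y = sG c (br x y)" "br x (sG c y) = sG c (br x y)"
  "H (sG c x) y = sV c (H x y)" "H x (sG c y) = sV c (H x y)"
  "rhoL (sG c x) v = sV c (rhoL x v)" "rhoL x (sV c v) = sV c (rhoL x v)"
  "rhoR (sG c x) v = sV c (rhoR x v)" "rhoR x (sV c v) = sV c (rhoR x v)"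
  "K (sV c v) = sG c (K v)"
  using G.bilinear_br H_bilinear rhoL_linear rhoR_linear K_linear
  by (simp_all add: bilinear_map_def linear_map_to_gl_def Vector_Spaces.linear_iff)

lemma K_twisted: "br (K u) (K v) = K (twisted_bracket rhoL rhoR H K u v)"
  using operator by (simp add: twisted_rota_baxter_def twisted_bracket_def)

text \<open>The left side collects the \<open>H\<close> terms of a product \<open>a(bc)\<close> in
  the extension, the right side those of \<open>(ab)c + b(ac)\<close>.\<close>

lemma cocycle_eq:
  "rhoL x (H y z) + H x (br y z) = rhoL y (H x z) + rhoR z (H x y) + H (br x y) z + H y (br x z)"
proof -
  have "rhoL x (H y z) - rhoL y (H x z) - rhoR z (H x y)
          - H (br x y) z - H y (br x z) + H x (br y z) = 0"
    using cocycle by (simp add: leibniz_2cocycle_def)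
  then show ?thesis by (simp add: algebra_simps)
qed

definition extension_bracket :: "'g \<times> 'v \<Rightarrow> 'g \<times> 'v \<Rightarrow> 'g \<times> 'v" where
  "extension_bracket a b =
     (br (fst a) (fst b), rhoL (fst a) (snd b) + rhoR (fst b) (snd a) + H (fst a) (fst b))"

definition graph_embedding :: "'v \<Rightarrow> 'g \<times> 'v" where
  "graph_embedding u = (K u, u)"

definition graph_quotient :: "'g \<times> 'v \<Rightarrow> 'g" where
  "graph_quotient a = fst a - K (snd a)"

text \<open>Sums in the product are written componentwise in what follows, since the product carries no
  group structure in the imported theories.\<close>

lemma extension_leibniz:
  "extension_bracket a (extension_bracket b c) =
     (fst (extension_bracket (extension_bracket a b) c) + fst (extension_bracket b (extension_bracket a c)),
      snd (extension_bracket (extension_bracket a b) c) + snd (extension_bracket b (extension_bracket a c)))"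
proof -
  obtain x u y v z w where abc: "a = (x, u)" "b = (y, v)" "c = (z, w)"
    by (cases a, cases b, cases c)
  \<comment> \<open>Each representation axiom settles the terms in one of the vectors:
    \<open>L\<close> those in \<open>w\<close>, \<open>M\<close> those in \<open>v\<close>,
    \<open>R\<close> those in \<open>u\<close>. The terms in \<open>H\<close> are left to the
    cocycle identity.\<close>
  have L: "rhoL x (rhoL y w) = rhoL (br x y) w + rhoL y (rhoL x w)"
    by (simp add: rhoL_br)
  have M: "rhoL x (rhoR z v) = rhoR z (rhoL x v) + rhoR (br x z) v"
    by (simp add: rhoR_br_commutator)
  have R: "rhoR (br y z) u = rhoR z (rhoR y u) + rhoL y (rhoR z u)"
    by (simp add: rhoR_br_sum)
  have "snd (extension_bracket a (extension_bracket b c)) =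
      rhoL x (rhoL y w) + rhoL x (rhoR z v) + rhoR (br y z) u + (rhoL x (H y z) + H x (br y z))"
    by (simp add: abc extension_bracket_def add_simps algebra_simps)
  also have "\<dots> = snd (extension_bracket (extension_bracket a b) c)
      + snd (extension_bracket b (extension_bracket a c))"
    unfolding L M R cocycle_eq
    by (simp add: abc extension_bracket_def add_simps algebra_simps)
  finally show ?thesis
    by (simp add: prod_eq_iff extension_bracket_def flip: G.leibniz)
qed

text \<open>The first components agree by the twisted Rota-Baxter identity, the second by definition
  of the bracket.\<close>

lemma extension_bracket_graph:
  "extension_bracket (graph_embedding u) (graph_embedding v) =
     graph_embedding (twisted_bracket rhoL rhoR H K u v)"
  by (simp add: extension_bracket_def graph_embedding_def K_twisted) (simp add: twisted_bracket_def)

text \<open>The second component of \<open>graph_embedding\<close> is the identity, so the Leibniz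
  identity of the extension, read there on graph elements, is the one on \<open>V\<close>.\<close>

lemma twisted_bracket_leibniz:
  fixes u v w
  defines "t \<equiv> twisted_bracket rhoL rhoR H K"
  shows "t u (t v w) = t (t u v) w + t v (t u w)"
  using extension_leibniz[of "graph_embedding u" "graph_embedding v" "graph_embedding w"]
  unfolding t_def extension_bracket_graph by (simp add: graph_embedding_def)

text \<open>Since \<open>(x, v) = (K v, v) + (x - K v, 0)\<close> and the graph is a subalgebra, the action of the graph
  on the quotient can be computed on representatives in \<open>g\<close>.\<close>

lemma graph_quotient_left:
  "graph_quotient (extension_bracket (graph_embedding u) a) =
     rhoL_bar br rhoR H K u (graph_quotient a)"
proof -
  define x v where "x = graph_quotient a" and "v = snd a"
  have a: "a = (x + K v, v)"
    by (simp add: x_def v_def graph_quotient_def)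
  \<comment> \<open>By \<open>K_twisted\<close>, \<open>br (K u) (K v)\<close> cancels
    \<open>K\<close> of all terms involving \<open>v\<close>.\<close>
  have "graph_quotient (extension_bracket (graph_embedding u) a) = rhoL_bar br rhoR H K u x"
    by (simp add: a extension_bracket_def graph_embedding_def graph_quotient_def rhoL_bar_def
        add_simps K_twisted twisted_bracket_def algebra_simps)
  then show ?thesis by (simp add: x_def)
qed

lemma graph_quotient_right:
  "graph_quotient (extension_bracket a (graph_embedding u)) =
     rhoR_bar br rhoL H K u (graph_quotient a)"
proof -
  define x v where "x = graph_quotient a" and "v = snd a"
  have a: "a = (x + K v, v)"
    by (simp add: x_def v_def graph_quotient_def)
  have "graph_quotient (extension_bracket a (graph_embedding u)) = rhoR_bar br rhoL H K u x"
    by (simp add: a extension_bracket_def graph_embedding_def graph_quotient_def rhoR_bar_def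
        add_simps K_twisted twisted_bracket_def algebra_simps)
  then show ?thesis by (simp add: x_def)
qed

text \<open>Additivity of \<open>K\<close> makes \<open>graph_quotient\<close> additive, so the
  identity descends.\<close>

lemma graph_quotient_leibniz:
  "graph_quotient (extension_bracket a (extension_bracket b c)) =
     graph_quotient (extension_bracket (extension_bracket a b) c)
     + graph_quotient (extension_bracket b (extension_bracket a c))"
  by (subst extension_leibniz) (simp add: graph_quotient_def add_simps)

lemma twisted_bracket_bilinear: "bilinear_map sV sV sV (twisted_bracket rhoL rhoR H K)"
  using V.vector_space_axioms
  by (simp add: bilinear_map_def Vector_Spaces.linear_iff twisted_bracket_def add_simps scale_simps
      V.scale_right_distrib algebra_simps)

lemma rhoL_bar_linear: "linear_map_to_gl sV sG (rhoL_bar br rhoR H K)"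
  using V.vector_space_axioms G.vector_space_axioms
  by (simp add: linear_map_to_gl_def Vector_Spaces.linear_iff rhoL_bar_def add_simps scale_simps
      G.scale_right_diff_distrib algebra_simps)

lemma rhoR_bar_linear: "linear_map_to_gl sV sG (rhoR_bar br rhoL H K)"
  using V.vector_space_axioms G.vector_space_axioms
  by (simp add: linear_map_to_gl_def Vector_Spaces.linear_iff rhoR_bar_def add_simps scale_simps
      G.scale_right_diff_distrib algebra_simps)

lemma bar_representation:
  "leibniz_representation sV (twisted_bracket rhoL rhoR H K) sG
     (rhoL_bar br rhoR H K) (rhoR_bar br rhoL H K)"
proof -
  let ?t = "twisted_bracket rhoL rhoR H K"
  let ?L = "rhoL_bar br rhoR H K"
  let ?R = "rhoR_bar br rhoL H K"
  \<comment> \<open>Additivity at \<open>0 + 0\<close> yields \<open>K 0 = 0\<close>.\<close>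
  have quotient: "graph_quotient (x, 0) = x" for x
    using add_simps(9)[of 0 0] by (simp add: graph_quotient_def)
  note action = extension_bracket_graph graph_quotient_left graph_quotient_right quotient
  interpret T: leibniz_algebra sV ?t
    by unfold_locales (rule twisted_bracket_bilinear twisted_bracket_leibniz)+
  show ?thesis
  proof unfold_locales
    fix u v x
    let ?u = "graph_embedding u" and ?v = "graph_embedding v"
    \<comment> \<open>The three axioms arise from one identity, with the representative
      \<open>(x, 0)\<close> in the third, second and first slot in turn.\<close>
    show "?L (?t u v) x = ?L u (?L v x) - ?L v (?L u x)"
      using graph_quotient_leibniz[of ?u ?v "(x, 0)"] by (simp add: action)
    show "?R (?t u v) x = ?L u (?R v x) - ?R v (?L u x)"
      using graph_quotient_leibniz[of ?u "(x, 0)" ?v] by (simp add: action)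
    show "?R (?t u v) x = ?L u (?R v x) + ?R v (?R u x)"
      using graph_quotient_leibniz[of "(x, 0)" ?u ?v] by (simp add: action add.commute)
  qed (rule rhoL_bar_linear rhoR_bar_linear)+
qed

end

theorem proposition3p1:
  fixes sG :: "complex \<Rightarrow> 'g::ab_group_add \<Rightarrow> 'g"
    and br :: "'g \<Rightarrow> 'g \<Rightarrow> 'g"
    and sV :: "complex \<Rightarrow> 'v::ab_group_add \<Rightarrow> 'v"
    and rhoL rhoR :: "'g \<Rightarrow> 'v \<Rightarrow> 'v"
    and H :: "'g \<Rightarrow> 'g \<Rightarrow> 'v"
    and K :: "'v \<Rightarrow> 'g"
  assumes "leibniz_algebra sG br"
    and "leibniz_representation sG br sV rhoL rhoR"
    and "leibniz_2cocycle sG br sV rhoL rhoR H"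
    and "twisted_rota_baxter sG br sV rhoL rhoR H K"
  shows "leibniz_representation sV (twisted_bracket rhoL rhoR H K) sG
           (rhoL_bar br rhoR H K) (rhoR_bar br rhoL H K)"
  using assms
  by (intro twisted_rota_baxter_operator.bar_representation twisted_rota_baxter_operator.intro
      twisted_rota_baxter_operator_axioms.intro)

end
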